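(* Let $m,n\in\mathbb{N}$, $a_1,\dots,a_m,c_1,\dots,c_m\in\mathbb{N}$ and $b_1,\dots,b_m\in\mathbb{N}_0$. Then $$\sum_{(d_1,\dots,d_m)\in\{-1,1\}^m} d_md_{m-1}\cdots d_1\;S_{(a_m,b_m,d_mc_m),(a_{m-1},b_{m-1},d_{m-1}c_{m-1}),\dots,(a_1,b_1,d_1c_1)}(2n)=2^m\,S_{(2a_m,b_m-a_m,c_m),\dots,(2a_1,b_1-a_1,c_1)}(n).$$
   Context: Cyclotomic harmonic sums: for $a_i\in\mathbb{N}=\{1,2,\dots\}$, $c_i\in\mathbb{Z}\setminus\{0\}$, $n\in\mathbb{N}_0$ and $b_i\in\mathbb{N}_0$, $$S_{(a_1,b_1,c_1),\dots,(a_k,b_k,c_k)}(n)=\sum_{n\ge i_1\ge i_2\ge\cdots\ge i_k\ge1}\frac{\mathrm{sign}(c_1)^{i_1}}{(a_1i_1+b_1)^{|c_1|}}\cdots\frac{\mathrm{sign}(c_k)^{i_k}}{(a_ki_k+b_k)^{|c_k|}} .$$ The same formula is used as definition when some $b_i$ are negative integers, provided all $a_ij+b_i$ with $j\ge1$ are positive (as is the case for the right-hand side of the claim). *)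

theory Defs
  imports Complex_Main "HOL-Library.FuncSet"
begin

(* The triple (a, b, c) stands for the index (a_j, b_j, c_j) of a cyclotomic harmonic sum.
   The shift b is an integer so that negative shifts are allowed; the value is meaningful
   only if c is nonzero and a * i + b is positive for all i >= 1. *)
fun cyc_factor :: "nat \<times> int \<times> int \<Rightarrow> nat \<Rightarrow> real" where
  "cyc_factor (a, b, c) i = of_int (sgn c) ^ i / of_int (int a * int i + b) ^ nat \<bar>c\<bar>"

(* Summation indices i_1, ..., i_k with n >= i_1 >= ... >= i_k >= 1, as lists of length k. *)
definition descending_indices :: "nat \<Rightarrow> nat \<Rightarrow> nat list set" where
  "descending_indices k n = {is. length is = k \<and> set is \<subseteq> {1..n} \<and> sorted_wrt (\<ge>) is}"

lemma finite_descending_indices: "finite (descending_indices k n)"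
  by (rule finite_subset[OF _ finite_lists_length_eq[of "{1..n}" k]])
     (auto simp: descending_indices_def)

definition cyclotomic_sum :: "(nat \<times> int \<times> int) list \<Rightarrow> nat \<Rightarrow> real" where
  "cyclotomic_sum ps n =
     (\<Sum>is\<in>descending_indices (length ps) n. \<Prod>j<length ps. cyc_factor (ps ! j) (is ! j))"

end

theory Submission
  imports Defs
begin

text \<open>Exchanging the sums, the sum over the signs factorises for every index tuple, and
  \<open>1 - (-1) ^ i\<close> kills the tuples with an even entry. The remaining tuples are reparametrised by
  \<open>i = 2 * j - 1\<close>, for which \<open>a * i + b = 2 * a * j + (b - a)\<close>.\<close>

text \<open>The list runs from index \<open>m\<close> down to \<open>1\<close>, so position
  \<open>j\<close> carries index \<open>m - j\<close>. Products over indices are needed because the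
  sign functions \<open>d\<close> are indexed by \<open>{1..m}\<close>.\<close>

lemma prod_nth_map_rev_upt:
  fixes f :: "'b \<Rightarrow> 'c \<Rightarrow> 'd::comm_monoid_mult" and g :: "nat \<Rightarrow> 'b"
  shows "(\<Prod>j<m. f (map g (rev [1..<m+1]) ! j) (xs ! j)) = (\<Prod>i=1..m. f (g i) (xs ! (m - i)))"
  by (rule prod.reindex_bij_witness[of _ "\<lambda>i. m - i" "\<lambda>j. m - j"]) (auto simp: rev_nth Suc_diff_Suc simp del: upt_Suc)

lemma cyclotomic_sum_rev_upt:
  "cyclotomic_sum (map g (rev [1..<m+1])) n =
     (\<Sum>is\<in>descending_indices m n. \<Prod>i=1..m. cyc_factor (g i) (is ! (m - i)))"
  unfolding cyclotomic_sum_def prod_nth_map_rev_upt[symmetric] by (simp del: upt_Suc)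

text \<open>Since \<open>c\<close> is positive, \<open>d * int c\<close> has sign \<open>d\<close>
  and absolute value \<open>c\<close>. With \<open>x = a * i + b\<close> the two terms are
  \<open>1 / x ^ c\<close> and \<open>- (-1) ^ i / x ^ c\<close>, which add up for odd
  \<open>i\<close> and cancel for even \<open>i\<close>.\<close>

lemma sum_sign_cyc_factor:
  assumes "c \<ge> 1"
  shows "(\<Sum>d\<in>{-1, 1::int}. of_int d * cyc_factor (a, int b, d * int c) i) =
    (if odd i then 2 / (real a * real i + real b) ^ c else 0)"
  using assms by (auto simp: sgn_mult)

lemma cyc_factor_odd_index:
  assumes "c \<ge> 1" "j \<ge> 1"
  shows "2 / (real a * real (2 * j - 1) + real b) ^ c =
    2 * cyc_factor (2 * a, int b - int a, int c) j"
proof -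
  \<comment> \<open>Here \<open>j \<ge> 1\<close> keeps the natural subtraction
    \<open>2 * j - 1\<close> from truncating at 0.\<close>
  have "real a * real (2 * j - 1) + real b = real_of_int (int (2 * a) * int j + (int b - int a))"
    using assms by (simp add: of_nat_diff algebra_simps)
  then show ?thesis
    using assms(1) by (simp only: cyc_factor.simps) simp
qed

text \<open>Entrywise, \<open>j\<close> in \<open>{1..n}\<close> corresponds to the odd number
  \<open>2 * j - 1\<close> in \<open>{1..2 * n}\<close>, with inverse \<open>(i + 1) div 2\<close>.
  Both maps are monotone, so the descending order of the tuples is preserved.\<close>

lemma bij_betw_descending_indices_odd:
  "bij_betw (map (\<lambda>j. 2 * j - 1)) (descending_indices m n)
     {is \<in> descending_indices m (2 * n). \<forall>i\<in>set is. odd i}"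
proof (rule bij_betw_byWitness[where f' = "map (\<lambda>i. (i + 1) div 2)"])
  show "\<forall>js\<in>descending_indices m n. map (\<lambda>i. (i + 1) div 2) (map (\<lambda>j. 2 * j - 1) js) = js"
    by (auto simp: descending_indices_def intro!: map_idI)
  show "\<forall>is\<in>{is \<in> descending_indices m (2 * n). \<forall>i\<in>set is. odd i}.
      map (\<lambda>j. 2 * j - 1) (map (\<lambda>i. (i + 1) div 2) is) = is"
    by (auto intro!: map_idI elim!: oddE)
  show "map (\<lambda>j. 2 * j - 1) ` descending_indices m n
      \<subseteq> {is \<in> descending_indices m (2 * n). \<forall>i\<in>set is. odd i}"
    by (fastforce simp: descending_indices_def sorted_wrt_map elim!: sorted_wrt_mono_rel[rotated])
  show "map (\<lambda>i. (i + 1) div 2) ` {is \<in> descending_indices m (2 * n). \<forall>i\<in>set is. odd i}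
      \<subseteq> descending_indices m n"
    by (fastforce simp: descending_indices_def sorted_wrt_map elim!: sorted_wrt_mono_rel[rotated])
qed

theorem theorem4p6p4:
  fixes m n :: nat and a b c :: "nat \<Rightarrow> nat"
  assumes "m \<ge> 1" and "n \<ge> 1"
    and "\<And>i. i \<in> {1..m} \<Longrightarrow> a i \<ge> 1"
    and "\<And>i. i \<in> {1..m} \<Longrightarrow> c i \<ge> 1"
  shows "(\<Sum>d \<in> {1..m} \<rightarrow>\<^sub>E {-1, 1::int}.
            of_int (\<Prod>i=1..m. d i) *
            cyclotomic_sum (map (\<lambda>i. (a i, int (b i), d i * int (c i))) (rev [1..<m+1])) (2 * n))
         = 2 ^ m *
           cyclotomic_sum (map (\<lambda>i. (2 * a i, int (b i) - int (a i), int (c i))) (rev [1..<m+1])) n"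
    (is "?L = 2 ^ m * cyclotomic_sum (map ?g _) n")
proof -
  \<comment> \<open>\<open>F is i\<close> is the factor that remains at index \<open>i\<close> after
    summing over the sign \<open>d i\<close>.\<close>
  define F where "F is i = (if odd (is ! (m - i))
      then 2 / (real (a i) * real (is ! (m - i)) + real (b i)) ^ c i else 0)" for "is" i
  let ?odd = "{is \<in> descending_indices m (2 * n). \<forall>i\<in>set is. odd i}"
  have "?L = (\<Sum>is\<in>descending_indices m (2 * n). \<Sum>d \<in> {1..m} \<rightarrow>\<^sub>E {-1, 1}.
      \<Prod>i=1..m. of_int (d i) * cyc_factor (a i, int (b i), d i * int (c i)) (is ! (m - i)))"
    \<comment> \<open>The product of signs is merged into the product of factors, so that each
      \<open>d i\<close> occurs only in the factor of index \<open>i\<close>.\<close>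
    unfolding cyclotomic_sum_rev_upt sum_distrib_left of_int_prod prod.distrib by (rule sum.swap)
  also have "\<dots> = (\<Sum>is\<in>descending_indices m (2 * n). \<Prod>i=1..m. F is i)"
  proof (rule sum.cong[OF refl])
    fix "is" :: "nat list"
    have "(\<Prod>i=1..m. F is i) = (\<Prod>i=1..m. \<Sum>d\<in>{-1, 1}.
        of_int d * cyc_factor (a i, int (b i), d * int (c i)) (is ! (m - i)))"
      unfolding F_def using assms(4) by (intro prod.cong refl sum_sign_cyc_factor[symmetric])
    also have "\<dots> = (\<Sum>d \<in> {1..m} \<rightarrow>\<^sub>E {-1, 1}.
      \<Prod>i=1..m. of_int (d i) * cyc_factor (a i, int (b i), d i * int (c i)) (is ! (m - i)))"
      by (rule prod_sum_PiE) auto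
    finally show "(\<Sum>d \<in> {1..m} \<rightarrow>\<^sub>E {-1, 1}.
      \<Prod>i=1..m. of_int (d i) * cyc_factor (a i, int (b i), d i * int (c i)) (is ! (m - i))) =
      (\<Prod>i=1..m. F is i)" ..
  qed
  also have "\<dots> = (\<Sum>is\<in>?odd. \<Prod>i=1..m. F is i)"
  proof (rule sum.mono_neutral_right[OF finite_descending_indices], blast, rule ballI)
    fix "is" assume "is \<in> descending_indices m (2 * n) - ?odd"
    then obtain k where "k < m" "even (is ! k)"
      by (auto simp: descending_indices_def in_set_conv_nth)
    \<comment> \<open>Position \<open>k\<close> of the tuple belongs to index \<open>m - k\<close>;
      as \<open>k < m\<close>, this index is at least 1 and \<open>m - (m - k) = k\<close>.\<close>
    then have "m - k \<in> {1..m}" "F is (m - k) = 0"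
      by (auto simp: F_def)
    then show "(\<Prod>i=1..m. F is i) = 0"
      by (intro prod_zero) auto
  qed
  also have "\<dots> = (\<Sum>js\<in>descending_indices m n. \<Prod>i=1..m. F (map (\<lambda>j. 2 * j - 1) js) i)"
    by (rule sum.reindex_bij_betw[OF bij_betw_descending_indices_odd, symmetric])
  also have "\<dots> = (\<Sum>js\<in>descending_indices m n. \<Prod>i=1..m. 2 * cyc_factor (?g i) (js ! (m - i)))"
  proof (intro sum.cong prod.cong refl)
    fix js i assume "js \<in> descending_indices m n" and i: "i \<in> {1..m}"
    \<comment> \<open>The length bound allows \<open>map\<close> to be evaluated at position
      \<open>m - i\<close>; the entry being at least 1 is what \<open>cyc_factor_odd_index\<close>
      requires.\<close>
    then have "m - i < length js" "js ! (m - i) \<in> {1..n}"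
      by (auto simp: descending_indices_def subset_iff)
    then show "F (map (\<lambda>j. 2 * j - 1) js) i = 2 * cyc_factor (?g i) (js ! (m - i))"
      using cyc_factor_odd_index[OF assms(4)[OF i], of "js ! (m - i)"] by (simp add: F_def)
  qed
  also have "\<dots> = 2 ^ m * cyclotomic_sum (map ?g (rev [1..<m+1])) n"
    unfolding cyclotomic_sum_rev_upt prod.distrib sum_distrib_left by simp
  finally show ?thesis .
qed

end
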